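(* Let $D\subseteq\mathbb{C}$ be open, let $\varphi_1,\varphi_2,\psi$ be analytic functions on $D$, let $\alpha,\beta\in\mathbb{R}^{+}\setminus\{1\}$, and for $n=0,1,2,\dots$ let $\Theta_n(x)=\alpha^{\varphi_1(x)}\frac{d^n}{dx^n}\left(\psi(x)\beta^{-\varphi_2(x)}\right)$. Then for all $n\ge 0$ and $x\in D$, $$\sum_{p=0}^{n}\binom{n}{p}\left\{\ln\alpha\,\Theta_{n-p+1}(x)\psi^{(p)}(x)\varphi_1'(x)+\Theta_{n-p+1}(x)\psi^{(p+1)}(x)-\Theta_{n-p}'(x)\psi^{(p+1)}(x)\right\}$$ $$+\ln\beta\sum_{k=0}^{n}\sum_{p=0}^{n-k}\left\{\binom{n}{k}\binom{n-k}{p}\Theta_{n-k-p}'(x)\varphi_2^{(k+1)}(x)\psi^{(p)}(x)-\binom{n}{k}\binom{n-k}{p}\Theta_{n-k-p+1}(x)\psi^{(p)}(x)\varphi_2^{(k+1)}(x)\right\}=0.$$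
   Context: For $c>0$ and $w\in\mathbb{C}$, $c^{w}=e^{w\ln c}$ with $\ln$ the real natural logarithm. Primes and superscripts $(p)$ denote derivatives with respect to $x$. *)

theory Defs
  imports "HOL-Complex_Analysis.Complex_Analysis"
begin

lemma of_real_powr_eq_exp:
  fixes c :: real and w :: complex
  assumes "c > 0"
  shows "of_real c powr w = exp (w * of_real (ln c))"
  using assms by (simp add: powr_def Ln_of_real)

definition Theta ::
  "real \<Rightarrow> real \<Rightarrow> (complex \<Rightarrow> complex) \<Rightarrow> (complex \<Rightarrow> complex) \<Rightarrow> (complex \<Rightarrow> complex)
     \<Rightarrow> nat \<Rightarrow> complex \<Rightarrow> complex" where
  "Theta \<alpha> \<beta> \<phi>1 \<phi>2 \<psi> n x =
     of_real \<alpha> powr \<phi>1 x * (deriv ^^ n) (\<lambda>z. \<psi> z * of_real \<beta> powr (- \<phi>2 z)) x"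

end

theory Submission
  imports Defs
begin

text \<open>The function \<open>f = \<psi> \<beta>\<^bsup>-\<phi>2\<^esup>\<close> satisfies
  \<open>\<psi> f' = \<psi>' f - ln \<beta> \<phi>2' \<psi> f\<close>. Differentiating this \<open>n\<close> times
  by Leibniz' rule gives a linear relation between the derivatives of \<open>f\<close>. Since
  \<open>\<Theta>\<^sub>m' - \<Theta>\<^sub>m\<^sub>+\<^sub>1 = ln \<alpha> \<phi>1' \<Theta>\<^sub>m\<close>, the claimed left-hand side is that relation
  multiplied by \<open>ln \<alpha> \<phi>1' \<alpha>\<^bsup>\<phi>1\<^esup>\<close>.\<close>

lemma has_field_derivative_of_real_powr:
  fixes c :: real and g :: "complex \<Rightarrow> complex"
  assumes "c > 0" and "(g has_field_derivative g') (at x)"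
  shows "((\<lambda>z. of_real c powr g z) has_field_derivative
           of_real (ln c) * g' * of_real c powr g x) (at x)"
  unfolding of_real_powr_eq_exp[OF \<open>c > 0\<close>]
  by (rule derivative_eq_intros assms refl | simp add: mult_ac)+

text \<open>Both sides of \<open>eq\<close> are differentiated \<open>n\<close> times and expanded
  by Leibniz. The triple product takes two expansions: \<open>deriv h\<close> is split off first,
  then \<open>g * f\<close>, which produces the nested sum.\<close>

lemma higher_deriv_mult_diff_relation:
  fixes f g h :: "complex \<Rightarrow> complex"
  assumes D: "open D" "x \<in> D"
    and hol: "f holomorphic_on D" "g holomorphic_on D" "h holomorphic_on D"
    and eq: "\<And>z. z \<in> D \<Longrightarrow> g z * deriv f z = deriv g z * f z - b * (deriv h z * (g z * f z))"
  shows "(\<Sum>p=0..n. of_nat (n choose p) * (deriv ^^ p) g x * (deriv ^^ (n - p + 1)) f x) =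
         (\<Sum>p=0..n. of_nat (n choose p) * (deriv ^^ (p + 1)) g x * (deriv ^^ (n - p)) f x) -
         b * (\<Sum>k=0..n. of_nat (n choose k) * (deriv ^^ (k + 1)) h x *
           (\<Sum>p=0..n-k. of_nat ((n - k) choose p) * (deriv ^^ p) g x * (deriv ^^ (n - k - p)) f x))"
proof -
  note [holomorphic_intros] = hol holomorphic_deriv[OF _ \<open>open D\<close>]
  have "(deriv ^^ n) (\<lambda>z. g z * deriv f z) x =
        (deriv ^^ n) (\<lambda>z. deriv g z * f z - b * (deriv h z * (g z * f z))) x"
    \<comment> \<open>Higher derivatives are local, so equality on the open set \<open>D\<close>
      suffices.\<close>
    by (intro higher_deriv_transform_within_open[of _ D] holomorphic_intros D eq)
  also have "\<dots> = (deriv ^^ n) (\<lambda>z. deriv g z * f z) x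
                  - (deriv ^^ n) (\<lambda>z. b * (deriv h z * (g z * f z))) x"
    by (intro higher_deriv_diff[of _ D] holomorphic_intros D)
  also have "(deriv ^^ n) (\<lambda>z. b * (deriv h z * (g z * f z))) x =
             b * (deriv ^^ n) (\<lambda>z. deriv h z * (g z * f z)) x"
    by (intro higher_deriv_cmult[of _ D] holomorphic_intros D)
  \<comment> \<open>\<open>funpow_Suc_right\<close> peels derivatives off on the inside, so that
    order \<open>p + 1\<close> of \<open>g\<close> or \<open>h\<close> becomes order
    \<open>p\<close> of its \<open>deriv\<close>, as Leibniz yields.\<close>
  finally show ?thesis
    using D hol
    by (simp add: higher_deriv_mult[of _ D] holomorphic_deriv holomorphic_on_mult
          funpow_Suc_right del: funpow.simps)
qed

text \<open>Product rule: one term raises the order of the inner derivative, the other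
  differentiates the power of \<alpha>.\<close>

lemma deriv_Theta:
  assumes D: "open D" "x \<in> D"
    and hol: "\<phi>1 holomorphic_on D" "(\<lambda>z. \<psi> z * of_real \<beta> powr (- \<phi>2 z)) holomorphic_on D"
    and "\<alpha> > 0"
  shows "deriv (Theta \<alpha> \<beta> \<phi>1 \<phi>2 \<psi> m) x =
         Theta \<alpha> \<beta> \<phi>1 \<phi>2 \<psi> (m + 1) x + of_real (ln \<alpha>) * deriv \<phi>1 x * Theta \<alpha> \<beta> \<phi>1 \<phi>2 \<psi> m x"
proof -
  let ?f = "\<lambda>z. \<psi> z * of_real \<beta> powr (- \<phi>2 z)"
  have "((deriv ^^ m) ?f has_field_derivative (deriv ^^ Suc m) ?f x) (at x)"
    using holomorphic_derivI[OF holomorphic_higher_deriv[OF hol(2) D(1)] D] by simp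
  from DERIV_mult[OF has_field_derivative_of_real_powr[OF \<open>\<alpha> > 0\<close> holomorphic_derivI[OF hol(1) D]] this]
  show ?thesis
    unfolding Theta_def by (intro DERIV_imp_deriv) (simp add: algebra_simps)
qed

theorem theorem4:
  fixes D :: "complex set" and \<phi>1 \<phi>2 \<psi> :: "complex \<Rightarrow> complex"
    and \<alpha> \<beta> :: real and n :: nat and x :: complex
    and \<Theta> :: "nat \<Rightarrow> complex \<Rightarrow> complex"
  assumes "open D"
    and "\<phi>1 analytic_on D" and "\<phi>2 analytic_on D" and "\<psi> analytic_on D"
    and "\<alpha> > 0" and "\<alpha> \<noteq> 1" and "\<beta> > 0" and "\<beta> \<noteq> 1"
    and "x \<in> D"
  defines "\<Theta> \<equiv> Theta \<alpha> \<beta> \<phi>1 \<phi>2 \<psi>"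
  shows "(\<Sum>p=0..n. of_nat (n choose p) *
            (of_real (ln \<alpha>) * \<Theta> (n - p + 1) x * (deriv ^^ p) \<psi> x * deriv \<phi>1 x
             + \<Theta> (n - p + 1) x * (deriv ^^ (p + 1)) \<psi> x
             - deriv (\<Theta> (n - p)) x * (deriv ^^ (p + 1)) \<psi> x))
         + of_real (ln \<beta>) * (\<Sum>k=0..n. \<Sum>p=0..n-k.
            (of_nat (n choose k) * of_nat ((n - k) choose p)
               * deriv (\<Theta> (n - k - p)) x * (deriv ^^ (k + 1)) \<phi>2 x * (deriv ^^ p) \<psi> x
             - of_nat (n choose k) * of_nat ((n - k) choose p)
               * \<Theta> (n - k - p + 1) x * (deriv ^^ p) \<psi> x * (deriv ^^ (k + 1)) \<phi>2 x)) = 0"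
    (is "?S + _ * ?T = 0")
proof -
  define f where "f = (\<lambda>z. \<psi> z * of_real \<beta> powr (- \<phi>2 z))"
  \<comment> \<open>\<open>a\<close> and \<open>E\<close> are values at the fixed point
    \<open>x\<close>, so \<open>a * E\<close> can be pulled out of every sum.\<close>
  define a where "a = of_real (ln \<alpha>) * deriv \<phi>1 x"
  define E where "E = of_real \<alpha> powr \<phi>1 x"
  have hol: "\<phi>1 holomorphic_on D" "\<phi>2 holomorphic_on D" "\<psi> holomorphic_on D"
    using assms analytic_imp_holomorphic by auto
  have f': "(f has_field_derivative
      deriv \<psi> z * of_real \<beta> powr (- \<phi>2 z) - of_real (ln \<beta>) * (deriv \<phi>2 z * f z)) (at z)"
    if "z \<in> D" for z
    unfolding f_def
    by (rule DERIV_cong, rule DERIV_mult[OF holomorphic_derivI[OF hol(3) \<open>open D\<close> that]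
          has_field_derivative_of_real_powr[OF \<open>\<beta> > 0\<close>
            DERIV_minus[OF holomorphic_derivI[OF hol(2) \<open>open D\<close> that]]]])
       (simp add: algebra_simps)
  have hol_f: "f holomorphic_on D"
    using f' \<open>open D\<close> by (auto simp: holomorphic_on_open)
  \<comment> \<open>Multiplying by \<psi> turns the bare power of \<beta> in \<open>f'\<close> into
    \<open>f\<close>; nothing is divided by \<psi>, which may vanish.\<close>
  have ode: "\<psi> z * deriv f z = deriv \<psi> z * f z - of_real (ln \<beta>) * (deriv \<phi>2 z * (\<psi> z * f z))"
    if "z \<in> D" for z
    unfolding DERIV_imp_deriv[OF f'[OF that]] by (simp add: f_def algebra_simps)
  have \<Theta>: "\<Theta> m x = E * (deriv ^^ m) f x" for m
    by (simp add: \<Theta>_def Theta_def E_def f_def)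
  have \<Theta>': "deriv (\<Theta> m) x = \<Theta> (m + 1) x + a * \<Theta> m x" for m
    using deriv_Theta[OF \<open>open D\<close> \<open>x \<in> D\<close> hol(1) hol_f[unfolded f_def] \<open>\<alpha> > 0\<close>]
    by (simp add: \<Theta>_def a_def)
  \<comment> \<open>The first term of each summand carries \<open>a\<close> already; in the other
    two, \<open>\<Theta>'\<close> cancels the higher-order parts and leaves a multiple of
    \<open>a\<close>.\<close>
  have "?S = (\<Sum>p=0..n. a * E * (of_nat (n choose p) * (deriv ^^ p) \<psi> x * (deriv ^^ (n - p + 1)) f x
                - of_nat (n choose p) * (deriv ^^ (p + 1)) \<psi> x * (deriv ^^ (n - p)) f x))"
    unfolding \<Theta>' unfolding \<Theta> by (intro sum.cong refl) (simp add: a_def algebra_simps)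
  also have "\<dots> = a * E * ((\<Sum>p=0..n. of_nat (n choose p) * (deriv ^^ p) \<psi> x * (deriv ^^ (n - p + 1)) f x)
                - (\<Sum>p=0..n. of_nat (n choose p) * (deriv ^^ (p + 1)) \<psi> x * (deriv ^^ (n - p)) f x))"
    by (simp only: sum_distrib_left [symmetric] sum_subtractf)
  also have "\<dots> = - of_real (ln \<beta>) * (a * E * (\<Sum>k=0..n. of_nat (n choose k) * (deriv ^^ (k + 1)) \<phi>2 x *
           (\<Sum>p=0..n-k. of_nat ((n - k) choose p) * (deriv ^^ p) \<psi> x * (deriv ^^ (n - k - p)) f x)))"
    by (subst higher_deriv_mult_diff_relation[OF \<open>open D\<close> \<open>x \<in> D\<close> hol_f hol(3,2) ode])
       (assumption, simp add: algebra_simps)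
  \<comment> \<open>In \<open>?T\<close> the same cancellation leaves \<open>a * E\<close> times the
    derivative of \<open>f\<close> of order \<open>n - k - p\<close>.\<close>
  also have "a * E * (\<Sum>k=0..n. of_nat (n choose k) * (deriv ^^ (k + 1)) \<phi>2 x *
           (\<Sum>p=0..n-k. of_nat ((n - k) choose p) * (deriv ^^ p) \<psi> x * (deriv ^^ (n - k - p)) f x)) = ?T"
    unfolding \<Theta>' unfolding \<Theta> sum_distrib_left by (intro sum.cong refl) (simp add: algebra_simps)
  finally show ?thesis
    by simp
qed

end
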